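(* Let $\mathcal{R}$ be a unital ring with involution, let $m\in\mathcal{R}$ be invertible with $m^*=m$, let $a,b,ab\in\mathcal{R}^{\mathrm{core},m}$, and suppose $a^*mb\,\mathcal{R}=mba^*\,\mathcal{R}$. Then $(ab)^{\mathrm{core},m}=b^{\mathrm{core},m}a^{\mathrm{core},m}$ if and only if both of the following hold: (i) $(b^{\mathrm{core},m}a)\mathcal{R}\subseteq(ab)\mathcal{R}\subseteq(ba)\mathcal{R}$; (ii) $m\,b\,b^{\mathrm{core},m}a\,a^{\mathrm{core},m}=m\,a\,a^{\mathrm{core},m}b\,b^{\mathrm{core},m}$ or $b\,b^{\mathrm{core},m}a\,a^{\mathrm{core},m}=a\,a^{\mathrm{core},m}b\,b^{\mathrm{core},m}$.
   Context: $\mathcal{R}$ is a (not necessarily commutative) unital ring with an involution $x\mapsto x^*$ satisfying $(xy)^*=y^*x^*$, $(x+y)^*=x^*+y^*$, $(x^* )^*=x$. For an invertible $m\in\mathcal{R}$ with $m^*=m$, an element $z\in\mathcal{R}$ is the $m$-weighted core inverse of $a\in\mathcal{R}$ if $aza=a$, $z\mathcal{R}=a\mathcal{R}$ and $\mathcal{R}z=\mathcal{R}a^*m$. It is unique if it exists and is denoted $a^{\mathrm{core},m}$; $\mathcal{R}^{\mathrm{core},m}$ is the set of elements that have an $m$-weighted core inverse. *)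

theory Defs
  imports Main
begin

text \<open>
  The sort \<open>{ring, monoid_mult}\<close> is that of unital rings, not necessarily commutative;
  unlike \<open>ring_1\<close> it admits the zero ring.
\<close>

definition ring_involution :: "('a::{ring, monoid_mult} \<Rightarrow> 'a) \<Rightarrow> bool" where
  "ring_involution star \<longleftrightarrow>
     (\<forall>x y. star (x * y) = star y * star x) \<and>
     (\<forall>x y. star (x + y) = star x + star y) \<and>
     (\<forall>x. star (star x) = x)"

definition ring_invertible :: "'a::{ring, monoid_mult} \<Rightarrow> bool" where
  "ring_invertible x \<longleftrightarrow> (\<exists>y. x * y = 1 \<and> y * x = 1)"

definition right_ideal :: "'a::{ring, monoid_mult} \<Rightarrow> 'a set" where
  "right_ideal x = {x * r | r. True}"

definition left_ideal :: "'a::{ring, monoid_mult} \<Rightarrow> 'a set" where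
  "left_ideal x = {r * x | r. True}"

definition is_wcore_inverse ::
  "('a::{ring, monoid_mult} \<Rightarrow> 'a) \<Rightarrow> 'a \<Rightarrow> 'a \<Rightarrow> 'a \<Rightarrow> bool" where
  "is_wcore_inverse star m a z \<longleftrightarrow>
     a * z * a = a \<and>
     right_ideal z = right_ideal a \<and>
     left_ideal z = left_ideal (star a * m)"

definition wcore_invertible ::
  "('a::{ring, monoid_mult} \<Rightarrow> 'a) \<Rightarrow> 'a \<Rightarrow> 'a set" where
  "wcore_invertible star m = {a. \<exists>z. is_wcore_inverse star m a z}"

text \<open>Meaningful only on \<open>wcore_invertible star m\<close>; see \<open>is_wcore_inverse_unique\<close>.\<close>

definition wcore ::
  "('a::{ring, monoid_mult} \<Rightarrow> 'a) \<Rightarrow> 'a \<Rightarrow> 'a \<Rightarrow> 'a" where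
  "wcore star m a = (THE z. is_wcore_inverse star m a z)"

lemma is_wcore_inverse_equations:
  fixes star :: "'a::{ring, monoid_mult} \<Rightarrow> 'a"
  assumes inv: "ring_involution star" and m: "ring_invertible m" "star m = m"
    and z: "is_wcore_inverse star m a z"
  shows "a * z * a = a" "star (m * (a * z)) = m * (a * z)" "z * a * z = z"
    "z * a * a = a" "a * z * z = z"
proof -
  have st: "star (x * y) = star y * star x" "star (star x) = x" for x y
    using inv by (auto simp: ring_involution_def)
  obtain n where n: "m * n = 1" "n * m = 1" using m by (auto simp: ring_invertible_def)
  have one: "star 1 = 1" by (metis st mult_1_left mult_1_right)
  have sn: "star n = n"
    by (metis n m(2) st(1) one mult.assoc mult_1_left mult_1_right)
  show aza: "a * z * a = a" using z by (simp add: is_wcore_inverse_def)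
  have "z \<in> left_ideal z"
    by (auto simp: left_ideal_def intro: exI[of _ 1])
  then have "z \<in> left_ideal (star a * m)" using z by (simp add: is_wcore_inverse_def)
  then obtain w where w: "z = w * (star a * m)" by (auto simp: left_ideal_def)
  have "z \<in> right_ideal z" "a \<in> right_ideal a"
    by (auto simp: right_ideal_def intro: exI[of _ 1])
  then have "z \<in> right_ideal a" "a \<in> right_ideal z"
    using z by (simp_all add: is_wcore_inverse_def)
  then obtain u v where u: "z = a * u" and v: "a = z * v" by (auto simp: right_ideal_def)
  have sz: "star z = m * (a * star w)" by (simp add: w st m mult.assoc)
  have nsz: "n * star z = a * star w"
    using n by (simp add: sz mult.assoc[symmetric])
  have "a * z * (n * star z) = n * star z"
    by (simp add: nsz mult.assoc[symmetric] aza)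
  then have "star (a * z * (n * star z)) = star (n * star z)" by simp
  then have zn: "z * n * star (a * z) = z * n" by (simp add: st sn mult.assoc)
  have h: "a * z * n * star (a * z) = a * z * n" using zn by (simp add: mult.assoc)
  have "star (a * z * n * star (a * z)) = a * z * n * star (a * z)"
    by (simp add: st sn mult.assoc)
  then have h2: "n * star (a * z) = a * z * n" by (simp add: h) (simp add: st sn mult.assoc)
  then have h3: "star (a * z) * m = m * (a * z)"
    by (metis n mult.assoc mult_1_left mult_1_right)
  show "star (m * (a * z)) = m * (a * z)" using h3 by (simp add: st m mult.assoc)
  have "z * (n * star (a * z)) = z * n" using zn by (simp add: mult.assoc)
  then have "z * (a * z * n) * m = z * n * m" by (simp add: h2)
  then show zaz: "z * a * z = z" using n by (simp add: mult.assoc)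
  show "z * a * a = a" using v zaz by (metis mult.assoc)
  show "a * z * z = z" using u aza by (metis mult.assoc)
qed

lemma is_wcore_inverse_unique:
  fixes star :: "'a::{ring, monoid_mult} \<Rightarrow> 'a"
  assumes inv: "ring_involution star" and m: "ring_invertible m" "star m = m"
    and y: "is_wcore_inverse star m a y" and z: "is_wcore_inverse star m a z"
  shows "y = z"
proof -
  note Y = is_wcore_inverse_equations[OF inv m y]
  note Z = is_wcore_inverse_equations[OF inv m z]
  have st: "star (x * y) = star y * star x" for x y
    using inv by (auto simp: ring_involution_def)
  obtain n where n: "m * n = 1" "n * m = 1" using m by (auto simp: ring_invertible_def)
  have "m * (a * y) = star (m * (a * z * (a * y)))"
    using Y(2) Z(1) by (simp add: mult.assoc[symmetric])
  also have "m * (a * z * (a * y)) = m * (a * z) * n * (m * (a * y))"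
    using n by (simp add: mult.assoc) (simp add: mult.assoc[symmetric])
  also have "star \<dots> = star (m * (a * y)) * (star n * star (m * (a * z)))"
    by (simp only: st)
  also have "\<dots> = m * (a * y) * (star n * (m * (a * z)))" by (simp only: Y(2) Z(2))
  also have "star n = n"
    by (metis n m(2) st mult.assoc mult_1_left mult_1_right)
  also have "m * (a * y) * (n * (m * (a * z))) = m * (a * z)"
    using n Y(1) by (metis mult.assoc mult_1_left)
  finally have "a * y = a * z" using n by (metis mult.assoc mult_1_left)
  then have "y = y * a * z" using Y(3) by (simp add: mult.assoc)
  also have "\<dots> = y * a * (a * z * z)" using Z(5) by simp
  also have "\<dots> = z" using Y(4) Z(5) by (metis mult.assoc)
  finally show ?thesis .
qed

end

theory Submission
  imports Defs
begin

text \<open>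
  Write \<open>x\<close> and \<open>y\<close> for the weighted core inverses of \<open>a\<close> and \<open>b\<close>, and put
  \<open>p = a x\<close>, \<open>q = b y\<close> and \<open>c = a b\<close>. The elements \<open>p\<close> and \<open>q\<close> are idempotents with ranges
  \<open>aR\<close> and \<open>bR\<close>, and they are self-adjoint for the weight: \<open>m p\<close> and \<open>m q\<close> are fixed by the
  involution. The proof rests on three observations.

  One inclusion of the ideal hypothesis says that the weighted adjoint of \<open>a\<close> maps \<open>bR\<close> into
  itself. Taking adjoints, \<open>q a q = q a\<close> (lemma \<open>range_projection_absorbs\<close>).

  If \<open>cR \<subseteq> bR\<close>, which follows from either side of the equivalence, then \<open>q c = c\<close>, and with
  the first observation \<open>c (y x) = a q x = q p\<close>. A product of two weighted self-adjoint elements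
  is weighted self-adjoint exactly when they commute, so condition (ii) says that \<open>c (y x)\<close> is
  weighted self-adjoint.

  For the sufficiency of (i) and (ii) it remains to see that \<open>cR \<subseteq> y x R\<close>. In finite dimension
  this would be a dimension count, since \<open>yaR \<subseteq> cR\<close> and \<open>b\<close> maps \<open>yaR\<close> onto \<open>cR\<close>. In a general
  ring, core invertibility of \<open>c\<close> replaces the count: left multiplication by \<open>c\<close> is injective
  on \<open>cR\<close>, and it takes the same value \<open>c c\<close> on \<open>c\<close> and on \<open>y x c c\<close>, both of which lie in \<open>cR\<close>.
  Hence \<open>y x c c = c\<close> (lemma \<open>reverse_product_fixes_square\<close>).
\<close>

lemma right_ideal_subset_iff:
  "right_ideal u \<subseteq> right_ideal v \<longleftrightarrow> (\<exists>r. u = v * r)"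
proof
  assume "right_ideal u \<subseteq> right_ideal v"
  moreover have "u \<in> right_ideal u"
    by (auto simp: right_ideal_def intro: exI[of _ 1])
  ultimately show "\<exists>r. u = v * r" by (auto simp: right_ideal_def)
next
  assume "\<exists>r. u = v * r"
  then show "right_ideal u \<subseteq> right_ideal v"
    by (auto simp: right_ideal_def mult.assoc)
qed

lemma left_ideal_subset_iff:
  "left_ideal u \<subseteq> left_ideal v \<longleftrightarrow> (\<exists>r. u = r * v)"
proof
  assume "left_ideal u \<subseteq> left_ideal v"
  moreover have "u \<in> left_ideal u"
    by (auto simp: left_ideal_def intro: exI[of _ 1])
  ultimately show "\<exists>r. u = r * v" by (auto simp: left_ideal_def)
next
  assume "\<exists>r. u = r * v"
  then show "left_ideal u \<subseteq> left_ideal v"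
    by (auto simp: left_ideal_def) (metis mult.assoc)
qed

lemma ring_invertible_left_cancel:
  assumes "ring_invertible m"
  shows "m * u = m * v \<longleftrightarrow> u = v"
  using assms unfolding ring_invertible_def by (metis mult.assoc mult_1_left)

lemma wcore_eqI:
  assumes "ring_involution star" "ring_invertible m" "star m = m"
    and "is_wcore_inverse star m a z"
  shows "wcore star m a = z"
  unfolding wcore_def using assms is_wcore_inverse_unique by (metis the_equality)

lemma is_wcore_inverse_wcore:
  assumes "ring_involution star" "ring_invertible m" "star m = m"
    and "a \<in> wcore_invertible star m"
  shows "is_wcore_inverse star m a (wcore star m a)"
  using assms wcore_eqI unfolding wcore_invertible_def by blast

text \<open>
  A converse to the equational properties of a weighted core inverse. The equality
  \<open>zR = cR\<close> of right ideals is replaced by \<open>z \<in> cR\<close> and \<open>z c c = c\<close>, and the equality of left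
  ideals by self-adjointness of \<open>m c z\<close>, which turns \<open>z = z (c z)\<close> into a left multiple of
  \<open>c\<^sup>* m\<close>.
\<close>
lemma is_wcore_inverseI:
  fixes star :: "'a::{ring, monoid_mult} \<Rightarrow> 'a"
  assumes inv: "ring_involution star" and m: "ring_invertible m" "star m = m"
    and czc: "c * z * c = c" and sym: "star (m * (c * z)) = m * (c * z)"
    and zcc: "z * c * c = c" and z: "z = c * k"
  shows "is_wcore_inverse star m c z"
proof -
  have st: "star (u * v) = star v * star u" for u v
    using inv by (auto simp: ring_involution_def)
  obtain n where n: "n * m = 1" using m by (auto simp: ring_invertible_def)
  have zcz: "z * c * z = z" using zcc z by (metis mult.assoc)
  have sym': "star z * star c * m = m * (c * z)" using sym by (simp add: st m mult.assoc)
  have "right_ideal z = right_ideal c"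
    using z zcc by (metis mult.assoc right_ideal_subset_iff subset_antisym)
  moreover have "z = z * n * star z * (star c * m)"
  proof -
    have "z * n * star z * (star c * m) = z * n * (star z * star c * m)"
      by (simp add: mult.assoc)
    also have "\<dots> = z * (n * m) * (c * z)" by (simp only: sym'[unfolded mult.assoc] mult.assoc)
    also have "\<dots> = z" using n zcz by (simp add: mult.assoc)
    finally show ?thesis by simp
  qed
  moreover have "star c * m = star c * m * c * z"
  proof -
    have "star c * m = star (c * z * c) * m" by (simp only: czc)
    also have "\<dots> = star c * (star z * star c * m)" by (simp add: st mult.assoc)
    also have "\<dots> = star c * m * c * z" by (simp only: sym'[unfolded mult.assoc] mult.assoc)
    finally show ?thesis .
  qed
  ultimately show ?thesis
    unfolding is_wcore_inverse_def using czc left_ideal_subset_iff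
    by (metis subset_antisym)
qed

text \<open>
  The hypothesis says that the weighted adjoint \<open>m\<^sup>-\<^sup>1 a\<^sup>* m\<close> of \<open>a\<close> maps \<open>bR\<close>, the range of
  the weighted self-adjoint idempotent \<open>b y\<close>, into itself. Hence \<open>a\<close> leaves the complementary
  kernel of \<open>b y\<close> invariant, which is the conclusion.
\<close>
lemma range_projection_absorbs:
  fixes star :: "'a::{ring, monoid_mult} \<Rightarrow> 'a"
  assumes inv: "ring_involution star" and m: "ring_invertible m" "star m = m"
    and y: "is_wcore_inverse star m b y"
    and sub: "right_ideal (star a * m * b) \<subseteq> right_ideal (m * b)"
  shows "b * y * a * (b * y) = b * y * a"
proof -
  note Y = is_wcore_inverse_equations[OF inv m y]
  have st: "star (u * v) = star v * star u" "star (star u) = u" for u v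
    using inv by (auto simp: ring_involution_def)
  obtain r where r: "star a * m * b = m * b * r"
    using sub by (auto simp: right_ideal_subset_iff)
  have "star (star a * m * b) = star (m * b * r)" by (simp only: r)
  then have r': "star b * m * a = star r * star b * m" by (simp add: st m mult.assoc)
  have sym: "star y * star b * m = m * b * y" using Y(2) by (simp add: st m mult.assoc)
  have fix_b: "star b * m * b * y = star b * m"
  proof -
    have "star b * m * b * y = star b * (star y * star b * m)"
      by (simp only: sym[unfolded mult.assoc] mult.assoc)
    also have "\<dots> = star (b * y * b) * m" by (simp add: st mult.assoc)
    finally show ?thesis by (simp only: Y(1))
  qed
  have mqa: "m * b * y * a = star y * star r * (star b * m)"
  proof -
    have "m * b * y * a = star y * (star b * m * a)"
      by (simp only: sym[symmetric]) (simp only: mult.assoc)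
    then show ?thesis by (simp only: r') (simp only: mult.assoc)
  qed
  have "m * b * y * a * (b * y) = star y * star r * (star b * m * b * y)"
    unfolding mqa by (simp only: mult.assoc)
  also have "\<dots> = m * b * y * a" by (simp only: fix_b mqa)
  finally have "m * (b * y * a * (b * y)) = m * (b * y * a)" by (simp only: mult.assoc)
  then show ?thesis by (simp add: ring_invertible_left_cancel[OF m(1)])
qed

lemma weighted_selfadjoint_mult_iff_commute:
  fixes star :: "'a::{ring, monoid_mult} \<Rightarrow> 'a"
  assumes inv: "ring_involution star" and m: "ring_invertible m" "star m = m"
    and p: "star (m * p) = m * p" and q: "star (m * q) = m * q"
  shows "star (m * (q * p)) = m * (q * p) \<longleftrightarrow> q * p = p * q"
proof -
  have st: "star (u * v) = star v * star u" for u v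
    using inv by (auto simp: ring_involution_def)
  have "star (m * (q * p)) = star p * star (m * q)" by (simp add: st mult.assoc)
  also have "\<dots> = star (m * p) * q" unfolding q by (simp add: st m mult.assoc)
  also have "\<dots> = m * (p * q)" by (simp add: p mult.assoc)
  finally show ?thesis using ring_invertible_left_cancel[OF m(1)] by metis
qed

text \<open>
  If \<open>abR \<subseteq> bR\<close> then \<open>a\<close> also leaves the range of \<open>b y\<close> invariant, so with the preceding
  invariance of the kernel it commutes with this idempotent.
\<close>
lemma range_projection_commutes:
  fixes a b y :: "'a::{ring, monoid_mult}"
  assumes absorb: "b * y * a * (b * y) = b * y * a"
    and fixes_ab: "b * y * (a * b) = a * b"
  shows "b * y * a = a * (b * y)"
proof -
  have "b * y * a * (b * y) = b * y * (a * b) * y" by (simp only: mult.assoc)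
  then show ?thesis by (simp only: absorb fixes_ab) (simp only: mult.assoc)
qed

text \<open>
  With \<open>c = a b\<close>, the element \<open>y x c c\<close> lies in \<open>yaR \<subseteq> cR\<close>, because \<open>xR = aR\<close>. Left
  multiplication by \<open>c\<close> is injective on \<open>cR\<close>, with left inverse \<open>w\<close>, and
  \<open>c (y x c c) = (b y) (a x) (c c) = c c\<close>.
\<close>
lemma reverse_product_fixes_square:
  fixes a b x y w :: "'a::{ring, monoid_mult}"
  assumes comm: "b * y * a = a * (b * y)"
    and axx: "a * x * x = x" and axa: "a * x * a = a" and byb: "b * y * b = b"
    and w: "w * (a * b) * (a * b) = a * b"
    and k: "y * a = a * b * k"
  shows "y * x * (a * b) * (a * b) = a * b"
proof -
  let ?c = "a * b"
  have fix_p: "a * x * ?c = ?c" using axa by (metis mult.assoc)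
  have fix_q: "b * y * ?c = ?c" using comm byb by (metis mult.assoc)
  have cyx: "?c * (y * x) = b * y * (a * x)" using comm by (metis mult.assoc)
  have in_cR: "y * x = ?c * (k * x * x)"
    using axx k by (metis mult.assoc)
  have "?c * (y * x * ?c * ?c) = ?c * (y * x) * ?c * ?c" by (simp only: mult.assoc)
  also have "\<dots> = b * y * (a * x * ?c) * ?c" by (simp only: cyx) (simp only: mult.assoc)
  also have "\<dots> = ?c * ?c" by (simp only: fix_p fix_q)
  finally have image: "?c * (y * x * ?c * ?c) = ?c * ?c" .
  have "y * x * ?c * ?c = w * ?c * ?c * (k * x * x) * ?c * ?c" by (simp only: in_cR w)
  also have "\<dots> = w * (?c * (y * x * ?c * ?c))" by (simp only: in_cR mult.assoc)
  also have "\<dots> = w * ?c * ?c" by (simp only: image) (simp only: mult.assoc)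
  finally show ?thesis by (simp only: w)
qed

lemma reverse_order_law_necessary:
  fixes star :: "'a::{ring, monoid_mult} \<Rightarrow> 'a"
  assumes inv: "ring_involution star" and m: "ring_invertible m" "star m = m"
    and x: "is_wcore_inverse star m a x" and y: "is_wcore_inverse star m b y"
    and absorb: "b * y * a * (b * y) = b * y * a"
    and yx: "is_wcore_inverse star m (a * b) (y * x)"
  shows "right_ideal (y * a) \<subseteq> right_ideal (a * b)"
    and "right_ideal (a * b) \<subseteq> right_ideal (b * a)"
    and "b * y * (a * x) = a * x * (b * y)"
proof -
  note X = is_wcore_inverse_equations[OF inv m x]
  note Y = is_wcore_inverse_equations[OF inv m y]
  note Z = is_wcore_inverse_equations[OF inv m yx]
  have ya: "y * a = a * b * (y * x * (y * x) * a * a)"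
  proof -
    have "y * a = y * x * a * a" using X(4) by (metis mult.assoc)
    also have "\<dots> = a * b * (y * x) * (y * x) * a * a" by (simp only: Z(5))
    finally show ?thesis by (simp only: mult.assoc)
  qed
  then show "right_ideal (y * a) \<subseteq> right_ideal (a * b)"
    by (auto simp: right_ideal_subset_iff)
  \<comment> \<open>As \<open>abR = yxR\<close>, the range of \<open>a b\<close> lies in that of \<open>y\<close>, which is \<open>bR\<close>.\<close>
  have fix_q: "b * y * (a * b) = a * b" using Z(4) Y(5) by (metis mult.assoc)
  have cz: "a * b * (y * x) = b * y * (a * x)"
    using range_projection_commutes[OF absorb fix_q] by (metis mult.assoc)
  show "b * y * (a * x) = a * x * (b * y)"
    using weighted_selfadjoint_mult_iff_commute[OF inv m X(2) Y(2)] Z(2)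
    unfolding cz by blast
  have "a * b = b * y * (a * x) * (a * b)" using Z(1) unfolding cz by simp
  also have "\<dots> = b * (y * a) * (x * (a * b))" by (simp only: mult.assoc)
  also have "\<dots> = b * a * (b * (y * x * (y * x) * a * a) * (x * (a * b)))"
    by (subst ya) (simp only: mult.assoc)
  finally show "right_ideal (a * b) \<subseteq> right_ideal (b * a)"
    using right_ideal_subset_iff by blast
qed

lemma reverse_order_law_sufficient:
  fixes star :: "'a::{ring, monoid_mult} \<Rightarrow> 'a"
  assumes inv: "ring_involution star" and m: "ring_invertible m" "star m = m"
    and x: "is_wcore_inverse star m a x" and y: "is_wcore_inverse star m b y"
    and w: "is_wcore_inverse star m (a * b) w"
    and absorb: "b * y * a * (b * y) = b * y * a"
    and ya: "right_ideal (y * a) \<subseteq> right_ideal (a * b)"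
    and ab: "right_ideal (a * b) \<subseteq> right_ideal b"
    and pq: "b * y * (a * x) = a * x * (b * y)"
  shows "is_wcore_inverse star m (a * b) (y * x)"
proof -
  note X = is_wcore_inverse_equations[OF inv m x]
  note Y = is_wcore_inverse_equations[OF inv m y]
  note W = is_wcore_inverse_equations[OF inv m w]
  obtain k where k: "y * a = a * b * k" using ya by (auto simp: right_ideal_subset_iff)
  obtain t where t: "a * b = b * t" using ab by (auto simp: right_ideal_subset_iff)
  have fix_q: "b * y * (a * b) = a * b" using t Y(1) by (metis mult.assoc)
  note comm = range_projection_commutes[OF absorb fix_q]
  have cz: "a * b * (y * x) = b * y * (a * x)" using comm by (metis mult.assoc)
  have czc: "a * b * (y * x) * (a * b) = a * b"
    unfolding cz using fix_q X(1) by (metis mult.assoc)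
  have sym: "star (m * (a * b * (y * x))) = m * (a * b * (y * x))"
    unfolding cz using weighted_selfadjoint_mult_iff_commute[OF inv m X(2) Y(2)] pq by blast
  have z: "y * x = a * b * (k * x * x)" using X(5) k by (metis mult.assoc)
  show ?thesis
    using is_wcore_inverseI[OF inv m czc sym
        reverse_product_fixes_square[OF comm X(5) X(1) Y(1) W(4) k] z] .
qed

theorem theorem4p10:
  fixes star :: "'a::{ring, monoid_mult} \<Rightarrow> 'a" and m a b :: 'a
  assumes "ring_involution star"
    and "ring_invertible m" and "star m = m"
    and "a \<in> wcore_invertible star m"
    and "b \<in> wcore_invertible star m"
    and "a * b \<in> wcore_invertible star m"
    and "right_ideal (star a * m * b) = right_ideal (m * b * star a)"
  shows "wcore star m (a * b) = wcore star m b * wcore star m a \<longleftrightarrow>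
    (right_ideal (wcore star m b * a) \<subseteq> right_ideal (a * b) \<and>
     right_ideal (a * b) \<subseteq> right_ideal (b * a)) \<and>
    (m * b * wcore star m b * a * wcore star m a = m * a * wcore star m a * b * wcore star m b \<or>
     b * wcore star m b * a * wcore star m a = a * wcore star m a * b * wcore star m b)"
proof -
  note inv = assms(1) and m = assms(2,3)
  let ?x = "wcore star m a" and ?y = "wcore star m b"
  note x = is_wcore_inverse_wcore[OF inv m assms(4)]
    and y = is_wcore_inverse_wcore[OF inv m assms(5)]
    and w = is_wcore_inverse_wcore[OF inv m assms(6)]
  have "right_ideal (star a * m * b) \<subseteq> right_ideal (m * b)"
    using assms(7) by (auto simp: right_ideal_subset_iff)
  note absorb = range_projection_absorbs[OF inv m y this]
  have weighted: "m * b * ?y * a * ?x = m * a * ?x * b * ?y \<longleftrightarrow>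
      b * ?y * (a * ?x) = a * ?x * (b * ?y)"
    using ring_invertible_left_cancel[OF m(1), of "b * ?y * (a * ?x)" "a * ?x * (b * ?y)"]
    by (simp add: mult.assoc)
  have unweighted: "b * ?y * a * ?x = a * ?x * b * ?y \<longleftrightarrow>
      b * ?y * (a * ?x) = a * ?x * (b * ?y)"
    by (simp add: mult.assoc)
  have range_b: "right_ideal (b * a) \<subseteq> right_ideal b"
    by (auto simp: right_ideal_subset_iff)
  show ?thesis
    unfolding weighted unweighted
  proof (intro iffI conjI)
    assume "wcore star m (a * b) = ?y * ?x"
    with w have "is_wcore_inverse star m (a * b) (?y * ?x)" by simp
    note nec = reverse_order_law_necessary[OF inv m x y absorb this]
    show "right_ideal (?y * a) \<subseteq> right_ideal (a * b)" by (rule nec(1))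
    show "right_ideal (a * b) \<subseteq> right_ideal (b * a)" by (rule nec(2))
    show "b * ?y * (a * ?x) = a * ?x * (b * ?y) \<or> b * ?y * (a * ?x) = a * ?x * (b * ?y)"
      using nec(3) by blast
  next
    assume "(right_ideal (?y * a) \<subseteq> right_ideal (a * b) \<and>
        right_ideal (a * b) \<subseteq> right_ideal (b * a)) \<and>
      (b * ?y * (a * ?x) = a * ?x * (b * ?y) \<or> b * ?y * (a * ?x) = a * ?x * (b * ?y))"
    then have "is_wcore_inverse star m (a * b) (?y * ?x)"
      using reverse_order_law_sufficient[OF inv m x y w absorb] range_b by blast
    then show "wcore star m (a * b) = ?y * ?x" by (rule wcore_eqI[OF inv m])
  qed
qed

end
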